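(* Let $g$ be an $\omega$-Lie superalgebra over a field $\mathbb{K}$ of characteristic zero. If $\mathrm{QDer}^{\omega}(g)=\mathrm{QDer}(g)$ or $\mathrm{QC}^{\omega}(g)=\mathrm{QC}(g)$, then $$\mathrm{GDer}^{\omega}(g)=\mathrm{QDer}^{\omega}(g)+\mathrm{QC}^{\omega}(g).$$
   Context: $\mathbb{K}$ is a field of characteristic zero. An $\omega$-Lie superalgebra is a $\mathbb{Z}_2$-graded $\mathbb{K}$-vector space $g=g_{\bar 0}\oplus g_{\bar 1}$ with a bilinear bracket $[\cdot,\cdot]:g\times g\to g$ and a bilinear form $\omega:g\times g\to\mathbb{K}$ such that, for all $\alpha,\beta\in\mathbb{Z}_2$ and all homogeneous $x,y,z\in g$ (with $|x|\in\mathbb{Z}_2$ the degree of $x$): (1) $[g_\alpha,g_\beta]\subseteq g_{\alpha+\beta}$; (2) $[x,y]=-(-1)^{|x||y|}[y,x]$; (3) $(-1)^{|x||y|}[[y,z],x]+(-1)^{|y||z|}[[z,x],y]+(-1)^{|x||z|}[[x,y],z]=(-1)^{|x||y|}\omega(y,z)x+(-1)^{|y||z|}\omega(z,x)y+(-1)^{|x||z|}\omega(x,y)z$; (4) $\omega(g_{\bar 0},g_{\bar 1})=0$. $\mathrm{End}(g)$ is the space of linear endomorphisms with its $\mathbb{Z}_2$-grading; $|d|$ is the degree of a homogeneous $d$. All conditions below are for homogeneous $x\in g$ and all $y\in g$. A homogeneous linear map $d$ is: - a generalized derivation if there are linear maps $d',d''$ homogeneous of degree $|d|$ with $d''([x,y])=[d(x),y]+(-1)^{|d||x|}[x,d'(y)]$;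 - a quasiderivation if there is a linear map $d'$ homogeneous of degree $|d|$ with $d'([x,y])=[d(x),y]+(-1)^{|d||x|}[x,d(y)]$; - in the quasicentroid if $[d(x),y]=(-1)^{|d||x|}[x,d(y)]$; - compatible if $\omega(d(x),y)+(-1)^{|d||x|}\omega(x,d(y))=0$. $\mathrm{GDer}(g)$, $\mathrm{QDer}(g)$, $\mathrm{QC}(g)$ denote the graded subspaces of $\mathrm{End}(g)$ spanned by the homogeneous generalized derivations, quasiderivations and elements of the quasicentroid, respectively. $\mathrm{GDer}^{\omega}(g)$, $\mathrm{QDer}^{\omega}(g)$, $\mathrm{QC}^{\omega}(g)$ denote the graded subspaces spanned by the compatible homogeneous elements of these. *)

theory Defs
  imports Complex_Main "HOL-Library.Z2" "HOL-Library.Function_Algebras" "HOL-Library.Set_Algebras"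
begin

text \<open>Degrees live in the type \<open>bit\<close>, i.e. the field with two elements, so \<open>+\<close> and \<open>*\<close> on degrees
  are computed modulo 2.  The scalar \<open>par_sign (a * b)\<close> is the sign $(-1)^{ab}$.\<close>

definition par_sign :: "bit \<Rightarrow> 'k::ring_1"
  where "par_sign a = (if a = 0 then 1 else - 1)"

text \<open>The underlying space is the whole type \<open>'g\<close>; \<open>G a\<close> is its homogeneous part of degree \<open>a\<close>.
  The zero vector is homogeneous of both degrees; all conditions below are trivial for it.\<close>

locale omega_lie_superalgebra = vector_space scale
  for scale :: "'k::field_char_0 \<Rightarrow> 'g::ab_group_add \<Rightarrow> 'g" (infixr "*s" 75) +
  fixes G :: "bit \<Rightarrow> 'g set"
    and br :: "'g \<Rightarrow> 'g \<Rightarrow> 'g"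
    and om :: "'g \<Rightarrow> 'g \<Rightarrow> 'k"
  assumes graded_subspace: "subspace (G a)"
    and graded_sum: "G 0 + G 1 = UNIV"
    and graded_direct: "G 0 \<inter> G 1 = {0}"
    and br_linear_left: "Vector_Spaces.linear scale scale (\<lambda>x. br x y)"
    and br_linear_right: "Vector_Spaces.linear scale scale (\<lambda>y. br x y)"
    and om_linear_left: "Vector_Spaces.linear scale (*) (\<lambda>x. om x y)"
    and om_linear_right: "Vector_Spaces.linear scale (*) (\<lambda>y. om x y)"
    and br_graded: "\<lbrakk>x \<in> G a; y \<in> G b\<rbrakk> \<Longrightarrow> br x y \<in> G (a + b)"
    and br_skew: "\<lbrakk>x \<in> G a; y \<in> G b\<rbrakk> \<Longrightarrow> br x y = - (par_sign (a * b) *s br y x)"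
    and omega_jacobi: "\<lbrakk>x \<in> G a; y \<in> G b; z \<in> G c\<rbrakk> \<Longrightarrow>
        par_sign (a * b) *s br (br y z) x
      + par_sign (b * c) *s br (br z x) y
      + par_sign (a * c) *s br (br x y) z
      = (par_sign (a * b) * om y z) *s x
      + (par_sign (b * c) * om z x) *s y
      + (par_sign (a * c) * om x y) *s z"
    and om_even_odd: "\<lbrakk>x \<in> G 0; y \<in> G 1\<rbrakk> \<Longrightarrow> om x y = 0"
begin

definition map_scale :: "'k \<Rightarrow> ('g \<Rightarrow> 'g) \<Rightarrow> 'g \<Rightarrow> 'g"
  where "map_scale c f = (\<lambda>x. c *s f x)"

text \<open>Spans of sets of endomorphisms are taken in the space of all maps with pointwise operations,
  which contains the linear endomorphisms as a subspace.\<close>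

sublocale End: vector_space map_scale
  by unfold_locales
    (simp_all add: map_scale_def fun_eq_iff scale_right_distrib scale_left_distrib)

definition homogeneous_end :: "bit \<Rightarrow> ('g \<Rightarrow> 'g) \<Rightarrow> bool"
  where "homogeneous_end e d \<longleftrightarrow>
    Vector_Spaces.linear scale scale d \<and> (\<forall>a. d ` G a \<subseteq> G (e + a))"

text \<open>In each predicate below, \<open>e\<close> is the degree of the map \<open>d\<close>.\<close>

definition generalized_derivation :: "bit \<Rightarrow> ('g \<Rightarrow> 'g) \<Rightarrow> bool"
  where "generalized_derivation e d \<longleftrightarrow> homogeneous_end e d \<and>
    (\<exists>d' d''. homogeneous_end e d' \<and> homogeneous_end e d'' \<and>
      (\<forall>a. \<forall>x\<in>G a. \<forall>y. d'' (br x y) = br (d x) y + par_sign (e * a) *s br x (d' y)))"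

definition quasiderivation :: "bit \<Rightarrow> ('g \<Rightarrow> 'g) \<Rightarrow> bool"
  where "quasiderivation e d \<longleftrightarrow> homogeneous_end e d \<and>
    (\<exists>d'. homogeneous_end e d' \<and>
      (\<forall>a. \<forall>x\<in>G a. \<forall>y. d' (br x y) = br (d x) y + par_sign (e * a) *s br x (d y)))"

definition quasicentral :: "bit \<Rightarrow> ('g \<Rightarrow> 'g) \<Rightarrow> bool"
  where "quasicentral e d \<longleftrightarrow> homogeneous_end e d \<and>
    (\<forall>a. \<forall>x\<in>G a. \<forall>y. br (d x) y = par_sign (e * a) *s br x (d y))"

definition compatible :: "bit \<Rightarrow> ('g \<Rightarrow> 'g) \<Rightarrow> bool"
  where "compatible e d \<longleftrightarrow>
    (\<forall>a. \<forall>x\<in>G a. \<forall>y. om (d x) y + par_sign (e * a) * om x (d y) = 0)"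

definition GDer :: "('g \<Rightarrow> 'g) set"
  where "GDer = End.span {d. \<exists>e. generalized_derivation e d}"

definition QDer :: "('g \<Rightarrow> 'g) set"
  where "QDer = End.span {d. \<exists>e. quasiderivation e d}"

definition QC :: "('g \<Rightarrow> 'g) set"
  where "QC = End.span {d. \<exists>e. quasicentral e d}"

definition GDer_omega :: "('g \<Rightarrow> 'g) set"
  where "GDer_omega = End.span {d. \<exists>e. generalized_derivation e d \<and> compatible e d}"

definition QDer_omega :: "('g \<Rightarrow> 'g) set"
  where "QDer_omega = End.span {d. \<exists>e. quasiderivation e d \<and> compatible e d}"

definition QC_omega :: "('g \<Rightarrow> 'g) set"
  where "QC_omega = End.span {d. \<exists>e. quasicentral e d \<and> compatible e d}"

end

end

theory Submission
  imports Defs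
begin

text \<open>For a generalized derivation \<open>d\<close> with companions \<open>d'\<close> and \<open>d''\<close>, skew-symmetry of the bracket lets
  \<open>d\<close> and \<open>d'\<close> change roles.  Hence \<open>(d + d') / 2\<close> is a quasiderivation and \<open>(d - d') / 2\<close> lies in the
  quasicentroid, and \<open>d\<close> is their sum.  The hypothesis makes one of the two summands compatible
  (a homogeneous sum of compatible maps is compatible, by uniqueness of homogeneous components), so if
  \<open>d\<close> is compatible, then the other summand is as well.\<close>

context omega_lie_superalgebra
begin

section \<open>Bilinearity and homogeneous components\<close>

lemma linear_iff_additive_homogeneous:
  "Vector_Spaces.linear scale scale f \<longleftrightarrow>
    (\<forall>x y. f (x + y) = f x + f y) \<and> (\<forall>c x. f (c *s x) = c *s f x)"
  by (auto simp: Vector_Spaces.linear_iff vector_space_axioms)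

lemma br_simps:
  "br (x + x') y = br x y + br x' y" "br x (y + y') = br x y + br x y'"
  "br (c *s x) y = c *s br x y" "br x (c *s y) = c *s br x y"
  using br_linear_left[of y] br_linear_right[of x]
  unfolding linear_iff_additive_homogeneous by auto

lemma om_simps:
  "om (x + x') y = om x y + om x' y" "om x (y + y') = om x y + om x y'"
  "om (c *s x) y = c * om x y" "om x (c *s y) = c * om x y"
  using om_linear_left[of y] om_linear_right[of x]
  unfolding Vector_Spaces.linear_iff by auto

lemma br_minus: "br (- x) y = - br x y" "br x (- y) = - br x y"
  using br_simps(3)[of "-1" x y] br_simps(4)[of x "-1" y] by simp_all

lemma om_zero: "om 0 y = 0" "om x 0 = 0"
  using om_simps(3)[of 0 0 y] om_simps(4)[of x 0 0] by simp_all

lemma homogeneous_decomposition: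
  obtains x0 x1 where "x0 \<in> G 0" "x1 \<in> G 1" "x = x0 + x1"
proof -
  have "x \<in> G 0 + G 1" using graded_sum by simp
  then show thesis using that by (auto elim: set_plus_elim)
qed

lemma homogeneous_end_linear:
  assumes "homogeneous_end e d"
  shows "d (x + y) = d x + d y" "d (c *s x) = c *s d x"
  using assms unfolding homogeneous_end_def linear_iff_additive_homogeneous by blast+

lemma homogeneous_end_degree:
  assumes "homogeneous_end e d" "x \<in> G a"
  shows "d x \<in> G (e + a)"
  using assms unfolding homogeneous_end_def by blast

section \<open>Homogeneous and compatible maps as subspaces of the space of all maps\<close>

lemma subspace_homogeneous_end: "End.subspace {d. homogeneous_end e d}"
proof (rule End.subspaceI; unfold mem_Collect_eq)
  show "homogeneous_end e 0"
    using subspace_0[OF graded_subspace]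
    by (simp add: homogeneous_end_def linear_iff_additive_homogeneous image_subset_iff)
next
  fix f g assume fg: "homogeneous_end e f" "homogeneous_end e g"
  have "(f + g) x \<in> G (e + a)" if "x \<in> G a" for a x
    using subspace_add[OF graded_subspace] fg[THEN homogeneous_end_degree, OF that]
    by (simp add: plus_fun_def)
  then show "homogeneous_end e (f + g)"
    unfolding homogeneous_end_def linear_iff_additive_homogeneous
    using fg[THEN homogeneous_end_linear(1)] fg[THEN homogeneous_end_linear(2)]
    by (simp only: image_subset_iff) (simp add: scale_right_distrib)
next
  fix c f assume f: "homogeneous_end e f"
  have "map_scale c f x \<in> G (e + a)" if "x \<in> G a" for a x
    using subspace_scale[OF graded_subspace] homogeneous_end_degree[OF f that]
    by (simp add: map_scale_def)
  then show "homogeneous_end e (map_scale c f)"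
    unfolding homogeneous_end_def linear_iff_additive_homogeneous
    using homogeneous_end_linear[OF f]
    by (simp only: image_subset_iff) (simp add: map_scale_def scale_right_distrib mult.commute)
qed

text \<open>For fixed \<open>e\<close> the sign depends only on the degree of \<open>x\<close>, not
  on the map, so the condition is linear in the map. Closure under subtraction is what later carries
  compatibility from a sum and one summand to the other summand.\<close>

lemma subspace_compatible: "End.subspace {d. compatible e d}"
proof (rule End.subspaceI; unfold mem_Collect_eq)
  show "compatible e 0"
    by (simp add: compatible_def om_zero)
next
  fix f g assume fg: "compatible e f" "compatible e g"
  show "compatible e (f + g)"
    unfolding compatible_def
  proof (intro allI ballI)
    fix a x y assume "x \<in> G a"
    then have "om (f x) y + par_sign (e * a) * om x (f y) = 0"
      "om (g x) y + par_sign (e * a) * om x (g y) = 0"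
      using fg by (auto simp: compatible_def)
    then show "om ((f + g) x) y + par_sign (e * a) * om x ((f + g) y) = 0"
      unfolding plus_fun_def om_simps by algebra
  qed
next
  fix c f assume f: "compatible e f"
  show "compatible e (map_scale c f)"
    unfolding compatible_def
  proof (intro allI ballI)
    fix a x y assume "x \<in> G a"
    then have "om (f x) y + par_sign (e * a) * om x (f y) = 0"
      using f by (auto simp: compatible_def)
    then show "om (map_scale c f x) y + par_sign (e * a) * om x (map_scale c f y) = 0"
      unfolding map_scale_def om_simps by algebra
  qed
qed

lemma subspace_homogeneous_compatible: "End.subspace {d. homogeneous_end e d \<and> compatible e d}"
  using End.subspace_inter[OF subspace_homogeneous_end subspace_compatible]
  by (simp add: Collect_conj_eq)

text \<open>Such a map sends each homogeneous vector into both graded parts, which meet only in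
  zero; additivity does the rest.\<close>

lemma homogeneous_end_both_degrees:
  assumes "homogeneous_end e d" "homogeneous_end (e + 1) d"
  shows "d = 0"
proof
  have zero: "d x = 0" if x: "x \<in> G a" for a x
  proof -
    have "d x \<in> G (e + a)" "d x \<in> G (e + a + 1)"
      using homogeneous_end_degree[OF assms(1) x] homogeneous_end_degree[OF assms(2) x]
      by (simp_all only: ac_simps)
    then have "d x \<in> G 0 \<inter> G 1" by (cases "e + a") auto
    then show ?thesis using graded_direct by simp
  qed
  fix x
  obtain x0 x1 where "x0 \<in> G 0" "x1 \<in> G 1" "x = x0 + x1" by (rule homogeneous_decomposition)
  then show "d x = 0 x" using zero homogeneous_end_linear(1)[OF assms(1)] by simp
qed

text \<open>The hypothesis of the theorem equates spans, not sets of homogeneous maps. Membership in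
  a span only gives a sum of compatible maps of both degrees; since \<open>f\<close> has degree
  \<open>e\<close>, the component of degree \<open>e + 1\<close> must vanish.\<close>

lemma compatible_if_in_span:
  assumes f: "homogeneous_end e f"
    and span: "f \<in> End.span {d. \<exists>e. homogeneous_end e d \<and> compatible e d}"
  shows "compatible e f"
proof -
  define A where "A b = {d. homogeneous_end b d \<and> compatible b d}" for b
  \<comment> \<open>Naming the two degrees relative to \<open>e\<close> turns the union over all
    degrees into a binary one, without a case split on \<open>e\<close> in what follows.\<close>
  have "b \<in> {e, e + 1}" for b by (cases b; cases e) auto
  then have degrees: "UNIV = {e, e + 1}" by blast
  have "{d. \<exists>b. homogeneous_end b d \<and> compatible b d} = (\<Union>b. A b)"
    by (auto simp: A_def)
  also have "\<dots> = A e \<union> A (e + 1)"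
    by (simp only: degrees UN_insert UN_empty Un_empty_right)
  finally have "f \<in> End.span (A e \<union> A (e + 1))" using span by (simp only:)
  moreover have "End.span (A b) = A b" for b
    unfolding A_def by (rule End.span_eq_iff[THEN iffD2, OF subspace_homogeneous_compatible])
  ultimately obtain g h where f_eq: "f = g + h" and g: "g \<in> A e" and h: "h \<in> A (e + 1)"
    by (auto simp only: End.span_Un)
  \<comment> \<open>The difference is \<open>h\<close>, which thus has degree \<open>e\<close> as
    well as \<open>e + 1\<close>.\<close>
  have "homogeneous_end e (f - g)"
    using End.subspace_diff[OF subspace_homogeneous_end, of f e g] f g by (simp add: A_def)
  then have "homogeneous_end e h" by (simp only: f_eq add_diff_cancel_left')
  then have "h = 0" using homogeneous_end_both_degrees[of e h] h by (simp only: A_def mem_Collect_eq)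
  then show ?thesis using f_eq g by (simp add: A_def)
qed

section \<open>Splitting a generalized derivation\<close>

text \<open>Apply the identity to \<open>br y x\<close> and turn all three brackets around by
  skew-symmetry. With \<open>b\<close> the degree of \<open>y\<close>, the exponents add up modulo
  2: \<open>a * b + (e + b) * a = e * a\<close> at \<open>br x (d y)\<close>, and
  \<open>a * b + e * b + b * (e + a) = 0\<close> at \<open>br (d' x) y\<close>.\<close>

lemma generalized_derivation_swap:
  assumes d: "homogeneous_end e d" and d': "homogeneous_end e d'" and d'': "homogeneous_end e d''"
    and eq: "\<And>a x y. x \<in> G a \<Longrightarrow> d'' (br x y) = br (d x) y + par_sign (e * a) *s br x (d' y)"
    and x: "x \<in> G a"
  shows "d'' (br x y) = br (d' x) y + par_sign (e * a) *s br x (d y)"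
proof -
  have hom: "d'' (br x y) = br (d' x) y + par_sign (e * a) *s br x (d y)" if y: "y \<in> G b" for b y
  proof -
    let ?s = "par_sign :: bit \<Rightarrow> 'k"
    have d''m: "d'' (- z) = - d'' z" for z
      using homogeneous_end_linear(2)[OF d'', of "-1" z] by simp
    have "d'' (br x y) = - (?s (a * b) *s d'' (br y x))"
      by (simp add: br_skew[OF x y] d''m homogeneous_end_linear(2)[OF d''])
    also have "\<dots> = - (?s (a * b) *s (br (d y) x + ?s (e * b) *s br y (d' x)))"
      by (simp add: eq[OF y])
    also have "br (d y) x = - (?s ((e + b) * a) *s br x (d y))"
      by (rule br_skew[OF homogeneous_end_degree[OF d y] x])
    also have "br y (d' x) = - (?s (b * (e + a)) *s br (d' x) y)"
      by (rule br_skew[OF y homogeneous_end_degree[OF d' x]])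
    also have "- (?s (a * b) *s (- (?s ((e + b) * a) *s br x (d y))
        + ?s (e * b) *s - (?s (b * (e + a)) *s br (d' x) y)))
      = br (d' x) y + ?s (e * a) *s br x (d y)"
      by (cases a; cases b; cases e) (simp_all add: par_sign_def)
    finally show ?thesis .
  qed
  \<comment> \<open>Skew-symmetry needed \<open>y\<close> homogeneous; both sides are additive in
    \<open>y\<close>, so the general case follows.\<close>
  obtain y0 y1 where "y0 \<in> G 0" "y1 \<in> G 1" "y = y0 + y1" by (rule homogeneous_decomposition)
  then show ?thesis
    by (simp add: br_simps hom homogeneous_end_linear(1)[OF d] homogeneous_end_linear(1)[OF d'']
        scale_right_distrib)
qed

lemma generalized_derivation_decomposition:
  assumes "generalized_derivation e d"
  obtains f h where "quasiderivation e f" "quasicentral e h" "d = f + h"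
proof -
  from assms obtain d' d'' where d: "homogeneous_end e d" and d': "homogeneous_end e d'"
    and d'': "homogeneous_end e d''"
    and eq: "\<And>a x y. x \<in> G a \<Longrightarrow> d'' (br x y) = br (d x) y + par_sign (e * a) *s br x (d' y)"
    unfolding generalized_derivation_def by blast
  note swap = generalized_derivation_swap[OF d d' d'' eq]
  let ?c = "1 / 2 :: 'k"
  \<comment> \<open>Characteristic zero enters here: 2 is invertible.\<close>
  have "?c + ?c = 1" by simp
  then have half: "?c *s z + ?c *s z = z" for z
    by (metis scale_left_distrib scale_one)
  define f where "f = map_scale ?c (d + d')"
  define h where "h = map_scale ?c (d - d')"
  note sub = subspace_homogeneous_end[of e]
  have f: "homogeneous_end e f"
    using End.subspace_scale[OF sub End.subspace_add[OF sub]] d d' by (simp add: f_def)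
  have h: "homogeneous_end e h"
    using End.subspace_scale[OF sub End.subspace_diff[OF sub]] d d' by (simp add: h_def)
  \<comment> \<open>The difference is written as a sum with a negative because the bracket rules
    \<open>br_simps\<close> and \<open>br_minus\<close> cover addition and negation only.\<close>
  have fx: "f x = ?c *s (d x + d' x)" and hx: "h x = ?c *s (d x + - d' x)" for x
    by (simp_all add: f_def h_def map_scale_def)
  have "d = f + h"
    by (simp add: fun_eq_iff fx hx scale_right_distrib scale_right_diff_distrib half)
  moreover have "quasiderivation e f"
    unfolding quasiderivation_def
  proof (intro conjI exI[of _ d''] allI ballI f d'')
    fix a x y assume x: "x \<in> G a"
    \<comment> \<open>Averaging the original and the swapped identity shows that \<open>d''\<close>
      itself serves as the companion of \<open>f\<close>.\<close>
    have "d'' (br x y) = ?c *s d'' (br x y) + ?c *s d'' (br x y)" by (rule half[symmetric])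
    also have "\<dots> = ?c *s (br (d x) y + par_sign (e * a) *s br x (d' y))
        + ?c *s (br (d' x) y + par_sign (e * a) *s br x (d y))"
      using eq[OF x] swap[OF _ x] by simp
    also have "\<dots> = br (f x) y + par_sign (e * a) *s br x (f y)"
      by (simp add: fx br_simps scale_right_distrib mult.commute)
    finally show "d'' (br x y) = br (f x) y + par_sign (e * a) *s br x (f y)" .
  qed
  moreover have "quasicentral e h"
    unfolding quasicentral_def
  proof (intro conjI allI ballI h)
    fix a x y assume x: "x \<in> G a"
    \<comment> \<open>Both sides equal \<open>d'' (br x y)\<close>; eliminating it leaves a
      condition on \<open>d - d'\<close> alone.\<close>
    have "br (d x) y + par_sign (e * a) *s br x (d' y) = br (d' x) y + par_sign (e * a) *s br x (d y)"
      using eq[OF x] swap[OF _ x] by simp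
    then have "br (d x) y + - br (d' x) y
        = par_sign (e * a) *s br x (d y) + - (par_sign (e * a) *s br x (d' y))"
      by (simp add: algebra_simps)
    then have "?c *s (br (d x) y + - br (d' x) y)
        = ?c *s (par_sign (e * a) *s br x (d y) + - (par_sign (e * a) *s br x (d' y)))"
      by simp
    then show "br (h x) y = par_sign (e * a) *s br x (h y)"
      by (simp add: hx br_simps br_minus scale_right_distrib scale_right_diff_distrib mult.commute
          del: add_uminus_conv_diff)
  qed
  ultimately show thesis using that by blast
qed

section \<open>Compatibility of the summands and the equality of spans\<close>

lemma quasiderivation_imp_generalized:
  "quasiderivation e d \<Longrightarrow> generalized_derivation e d"
  unfolding quasiderivation_def generalized_derivation_def by blast

text \<open>The companions are \<open>d' = - d\<close> and \<open>d'' = 0\<close>: the two terms on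
  the right then cancel.\<close>

lemma quasicentral_imp_generalized:
  assumes "quasicentral e d"
  shows "generalized_derivation e d"
  unfolding generalized_derivation_def
proof (rule conjI, goal_cases)
  case 1
  show d: "homogeneous_end e d" using assms by (simp add: quasicentral_def)
  case 2
  have "homogeneous_end e (- d)"
    using End.subspace_neg[OF subspace_homogeneous_end] d by blast
  moreover have "homogeneous_end e 0"
    using End.subspace_0[OF subspace_homogeneous_end] by blast
  moreover have "\<forall>a. \<forall>x\<in>G a. \<forall>y. 0 (br x y) = br (d x) y + par_sign (e * a) *s br x ((- d) y)"
    using assms by (simp add: quasicentral_def br_minus)
  ultimately show ?case
    by - (rule exI[of _ "- d"], rule exI[of _ 0], intro conjI)
qed

lemma QDer_omega_compatible:
  assumes "f \<in> QDer_omega" "homogeneous_end e f"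
  shows "compatible e f"
  by (rule compatible_if_in_span[OF assms(2)],
      rule subsetD[OF End.span_mono assms(1)[unfolded QDer_omega_def]])
    (auto simp: quasiderivation_def)

lemma QC_omega_compatible:
  assumes "h \<in> QC_omega" "homogeneous_end e h"
  shows "compatible e h"
  by (rule compatible_if_in_span[OF assms(2)],
      rule subsetD[OF End.span_mono assms(1)[unfolded QC_omega_def]])
    (auto simp: quasicentral_def)

text \<open>Writing the sum as one span makes it visibly a subspace and reduces its inclusion in
  \<open>GDer_omega\<close> to the generators.\<close>

lemma QDer_omega_plus_QC_omega:
  "QDer_omega + QC_omega = End.span ({d. \<exists>e. quasiderivation e d \<and> compatible e d} \<union>
     {d. \<exists>e. quasicentral e d \<and> compatible e d})"
  by (auto simp: QDer_omega_def QC_omega_def End.span_Un set_plus_def)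

lemma compatible_generalized_derivation_decomposition:
  assumes hyp: "QDer_omega = QDer \<or> QC_omega = QC"
    and d: "generalized_derivation e d" "compatible e d"
  obtains f h where "quasiderivation e f" "compatible e f" "quasicentral e h" "compatible e h" "d = f + h"
proof -
  obtain f h where f: "quasiderivation e f" and h: "quasicentral e h" and dfh: "d = f + h"
    using generalized_derivation_decomposition[OF d(1)] .
  have fh: "homogeneous_end e f" "homogeneous_end e h"
    using f h by (auto simp: quasiderivation_def quasicentral_def)
  have "f \<in> QDer" "h \<in> QC"
    unfolding QDer_def QC_def using f h by (auto intro: End.span_base)
  \<comment> \<open>If the two spans of quasiderivations agree, \<open>f\<close> lies in
    \<open>QDer_omega\<close>; if those of the quasicentroid agree, \<open>h\<close> lies in
    \<open>QC_omega\<close>. Homogeneity then gives compatibility.\<close>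
  then have "compatible e f \<or> compatible e h"
    using hyp fh QDer_omega_compatible QC_omega_compatible by blast
  moreover have "compatible e h" if "compatible e f"
    using End.subspace_diff[OF subspace_compatible, of d e f] d(2) that dfh by simp
  moreover have "compatible e f" if "compatible e h"
    using End.subspace_diff[OF subspace_compatible, of d e h] d(2) that dfh by simp
  ultimately show thesis using that f h dfh by blast
qed

lemma GDer_omega_eq:
  assumes "QDer_omega = QDer \<or> QC_omega = QC"
  shows "GDer_omega = QDer_omega + QC_omega"
proof
  show "GDer_omega \<subseteq> QDer_omega + QC_omega"
    unfolding GDer_omega_def
  proof (rule End.span_minimal)
    show "{d. \<exists>e. generalized_derivation e d \<and> compatible e d} \<subseteq> QDer_omega + QC_omega"
    proof clarify
      fix d e assume "generalized_derivation e d" "compatible e d"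
      then obtain f h where "quasiderivation e f" "compatible e f" "quasicentral e h" "compatible e h"
        and dfh: "d = f + h"
        using compatible_generalized_derivation_decomposition[OF assms] by blast
      then have "f \<in> QDer_omega" "h \<in> QC_omega"
        unfolding QDer_omega_def QC_omega_def by (auto intro: End.span_base)
      then show "d \<in> QDer_omega + QC_omega" unfolding dfh by (rule set_plus_intro)
    qed
    show "End.subspace (QDer_omega + QC_omega)"
      unfolding QDer_omega_plus_QC_omega by (rule End.subspace_span)
  qed
  show "QDer_omega + QC_omega \<subseteq> GDer_omega"
    unfolding QDer_omega_plus_QC_omega GDer_omega_def
    by (intro End.span_mono) (auto intro: quasiderivation_imp_generalized quasicentral_imp_generalized)
qed

end

theorem proposition3p7:
  fixes scale :: "'k::field_char_0 \<Rightarrow> 'g::ab_group_add \<Rightarrow> 'g"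
    and G :: "bit \<Rightarrow> 'g set"
    and br :: "'g \<Rightarrow> 'g \<Rightarrow> 'g"
    and om :: "'g \<Rightarrow> 'g \<Rightarrow> 'k"
  assumes "omega_lie_superalgebra scale G br om"
    and "omega_lie_superalgebra.QDer_omega scale G br om = omega_lie_superalgebra.QDer scale G br
       \<or> omega_lie_superalgebra.QC_omega scale G br om = omega_lie_superalgebra.QC scale G br"
  shows "omega_lie_superalgebra.GDer_omega scale G br om =
     omega_lie_superalgebra.QDer_omega scale G br om + omega_lie_superalgebra.QC_omega scale G br om"
  using assms by (rule omega_lie_superalgebra.GDer_omega_eq)

end
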